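(* Let $f:X\to Y$ be a pointed map of connected CW complexes. If $f$ induces a surjection $\pi_n(f):\pi_n(X)\to\pi_n(Y)$, then $\mathcal{G}_n(Y,X;f)=\pi_n(Y)$.
   Context: Here $n\ge 1$; maps and homotopies are pointed. For spaces $B,X$ let $i_X:X\to B\times X$, $i_X(x)=( *,x)$, and let $p_B:B\times X\to B$ be the projection; a section is a map $s:B\to B\times X$ with $p_B\circ s\simeq \mathrm{id}_B$. For a pointed map $f:X\to Y$, the $n$th relaxed evaluation subgroup $\mathcal{G}_n(Y,X;f)$ is the set of all $a\in\pi_n(Y)$ for which there exist a section $s:S^n\to S^n\times X$ and a map $F:S^n\times X\to Y$ such that $F\circ s\simeq a$ and $F\circ i_X\simeq f$. *)

theory Defs
  imports "HOL-Analysis.Analysis"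
begin

section \<open>CW complexes\<close>

definition disc :: "nat \<Rightarrow> (nat \<Rightarrow> real) topology" where
  "disc n = subtopology (Euclidean_space n) {x. (\<Sum>i<n. x i ^ 2) \<le> 1}"

definition open_disc :: "nat \<Rightarrow> (nat \<Rightarrow> real) set" where
  "open_disc n = {x \<in> topspace (Euclidean_space n). (\<Sum>i<n. x i ^ 2) < 1}"

definition disc_boundary :: "nat \<Rightarrow> (nat \<Rightarrow> real) set" where
  "disc_boundary n = {x \<in> topspace (Euclidean_space n). (\<Sum>i<n. x i ^ 2) = 1}"

text \<open>
  Whitehead's definition. \<open>E n\<close> is the collection of open \<open>n\<close>-cells, as subsets of \<open>X\<close>. The three
  conditions after the Hausdorff axiom say that the cells partition \<open>X\<close>; that every cell has a
  characteristic map carrying the boundary of the disc into finitely many cells of lower dimension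
  (closure finiteness); and that \<open>X\<close> has the weak topology with respect to the closed cells. The
  number of cells and the dimension are unrestricted.
\<close>
definition CW_structure :: "'a topology \<Rightarrow> (nat \<Rightarrow> 'a set set) \<Rightarrow> bool" where
  "CW_structure X E \<longleftrightarrow>
     Hausdorff_space X \<and>
     ((\<Union>n. \<Union>(E n)) = topspace X \<and>
      (\<forall>m n. \<forall>d\<in>E m. \<forall>e\<in>E n. (m, d) \<noteq> (n, e) \<longrightarrow> d \<inter> e = {})) \<and>
     (\<forall>n. \<forall>e\<in>E n. \<exists>\<Phi>.
        continuous_map (disc n) X \<Phi> \<and>
        homeomorphic_map (subtopology (disc n) (open_disc n)) (subtopology X e) \<Phi> \<and>
        (\<exists>D. finite D \<and> D \<subseteq> (\<Union>m<n. E m) \<and> \<Phi> ` disc_boundary n \<subseteq> \<Union>D)) \<and>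
     (\<forall>A\<subseteq>topspace X.
        (\<forall>n. \<forall>e\<in>E n. closedin X (A \<inter> X closure_of e)) \<longrightarrow> closedin X A)"

definition CW_complex :: "'a topology \<Rightarrow> bool" where
  "CW_complex X \<longleftrightarrow> (\<exists>E. CW_structure X E)"


section \<open>Pointed maps, pointed homotopy and homotopy groups\<close>

definition pointed_map ::
  "'a topology \<Rightarrow> 'a \<Rightarrow> 'b topology \<Rightarrow> 'b \<Rightarrow> ('a \<Rightarrow> 'b) \<Rightarrow> bool" where
  "pointed_map X x0 Y y0 f \<longleftrightarrow> continuous_map X Y f \<and> f x0 = y0"

definition pointed_homotopic ::
  "'a topology \<Rightarrow> 'a \<Rightarrow> 'b topology \<Rightarrow> 'b \<Rightarrow> ('a \<Rightarrow> 'b) \<Rightarrow> ('a \<Rightarrow> 'b) \<Rightarrow> bool" where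
  "pointed_homotopic X x0 Y y0 = homotopic_with (\<lambda>h. h x0 = y0) X Y"

definition pointed_class ::
  "'a topology \<Rightarrow> 'a \<Rightarrow> 'b topology \<Rightarrow> 'b \<Rightarrow> ('a \<Rightarrow> 'b) \<Rightarrow> ('a \<Rightarrow> 'b) set" where
  "pointed_class X x0 Y y0 f = {g. pointed_homotopic X x0 Y y0 f g}"

definition sphere_point :: "nat \<Rightarrow> real" where
  "sphere_point = (\<lambda>i. if i = 0 then 1 else 0)"

text \<open>
  The underlying set of \<open>\<pi>\<^sub>n(Y, y0)\<close>: pointed homotopy classes of pointed maps from the \<open>n\<close>-sphere
  (\<open>nsphere n\<close> is the unit sphere in \<open>\<real>\<^sup>n\<^sup>+\<^sup>1\<close>). The multiplication is not needed: surjectivity of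
  \<open>\<pi>\<^sub>n(f)\<close> and the relaxed evaluation subgroup only involve this set.
\<close>
definition homotopy_group ::
  "nat \<Rightarrow> 'b topology \<Rightarrow> 'b \<Rightarrow> ((nat \<Rightarrow> real) \<Rightarrow> 'b) set set" where
  "homotopy_group n Y y0 =
     {pointed_class (nsphere n) sphere_point Y y0 g |g. pointed_map (nsphere n) sphere_point Y y0 g}"

text \<open>
  \<open>\<pi>\<^sub>n(f)\<close>, defined without choosing a representative; see \<open>induced_map_class\<close> below.
\<close>
definition induced_map ::
  "nat \<Rightarrow> 'b topology \<Rightarrow> 'b \<Rightarrow> ('a \<Rightarrow> 'b)
    \<Rightarrow> ((nat \<Rightarrow> real) \<Rightarrow> 'a) set \<Rightarrow> ((nat \<Rightarrow> real) \<Rightarrow> 'b) set" where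
  "induced_map n Y y0 f a = (\<Union>g\<in>a. pointed_class (nsphere n) sphere_point Y y0 (f \<circ> g))"


section \<open>Sections and the relaxed evaluation subgroup\<close>

definition fibre_incl :: "'c \<Rightarrow> 'a \<Rightarrow> 'c \<times> 'a" where
  "fibre_incl b0 = (\<lambda>x. (b0, x))"

text \<open>A section is only required to be a section of the projection up to pointed homotopy.\<close>

definition homotopy_section ::
  "'c topology \<Rightarrow> 'c \<Rightarrow> 'a topology \<Rightarrow> 'a \<Rightarrow> ('c \<Rightarrow> 'c \<times> 'a) \<Rightarrow> bool" where
  "homotopy_section B b0 X x0 s \<longleftrightarrow>
     pointed_map B b0 (prod_topology B X) (b0, x0) s \<and>
     pointed_homotopic B b0 B b0 (fst \<circ> s) id"

definition relaxed_evaluation_subgroup ::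
  "nat \<Rightarrow> 'b topology \<Rightarrow> 'b \<Rightarrow> 'a topology \<Rightarrow> 'a \<Rightarrow> ('a \<Rightarrow> 'b)
    \<Rightarrow> ((nat \<Rightarrow> real) \<Rightarrow> 'b) set set" where
  "relaxed_evaluation_subgroup n Y y0 X x0 f =
     {a \<in> homotopy_group n Y y0.
        \<exists>s F. homotopy_section (nsphere n) sphere_point X x0 s \<and>
              pointed_map (prod_topology (nsphere n) X) (sphere_point, x0) Y y0 F \<and>
              pointed_class (nsphere n) sphere_point Y y0 (F \<circ> s) = a \<and>
              pointed_homotopic X x0 Y y0 (F \<circ> fibre_incl sphere_point) f}"


section \<open>Basic facts\<close>

lemma sphere_point_in_nsphere: "sphere_point \<in> topspace (nsphere n)"
proof -
  have "(\<Sum>i\<le>n. sphere_point i ^ 2) = (\<Sum>i\<le>n. if i = 0 then 1 else 0)"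
    by (rule sum.cong) (auto simp: sphere_point_def)
  also have "\<dots> = 1"
    by simp
  finally show ?thesis
    by (simp add: nsphere_def topspace_Euclidean_space) (simp add: sphere_point_def)
qed

lemma topspace_disc: "topspace (disc n) = open_disc n \<union> disc_boundary n"
  by (auto simp: disc_def open_disc_def disc_boundary_def)

lemma pointed_homotopic_refl:
  "pointed_homotopic X x0 Y y0 f f \<longleftrightarrow> pointed_map X x0 Y y0 f"
  by (auto simp: pointed_homotopic_def pointed_map_def)

lemma pointed_class_eq_iff:
  assumes "pointed_map X x0 Y y0 f"
  shows "pointed_class X x0 Y y0 f = pointed_class X x0 Y y0 g \<longleftrightarrow> pointed_homotopic X x0 Y y0 f g"
proof
  assume eq: "pointed_class X x0 Y y0 f = pointed_class X x0 Y y0 g"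
  have "f \<in> pointed_class X x0 Y y0 f"
    using assms by (simp add: pointed_class_def pointed_homotopic_refl)
  then show "pointed_homotopic X x0 Y y0 f g"
    unfolding eq by (simp add: pointed_class_def pointed_homotopic_def homotopic_with_symD)
next
  assume "pointed_homotopic X x0 Y y0 f g"
  then show "pointed_class X x0 Y y0 f = pointed_class X x0 Y y0 g"
    unfolding pointed_class_def pointed_homotopic_def
    by (blast dest: homotopic_with_trans homotopic_with_symD)
qed

lemma induced_map_class:
  assumes f: "pointed_map X x0 Y y0 f"
    and g: "pointed_map (nsphere n) sphere_point X x0 g"
  shows "induced_map n Y y0 f (pointed_class (nsphere n) sphere_point X x0 g)
       = pointed_class (nsphere n) sphere_point Y y0 (f \<circ> g)"
proof -
  let ?c = "\<lambda>h. pointed_class (nsphere n) sphere_point Y y0 (f \<circ> h)"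
  have fg: "pointed_map (nsphere n) sphere_point Y y0 (f \<circ> g)"
    using f g by (auto simp: pointed_map_def intro: continuous_map_compose)
  have "?c h = ?c g" if h: "pointed_homotopic (nsphere n) sphere_point X x0 g h" for h
  proof -
    have "pointed_homotopic (nsphere n) sphere_point Y y0 (f \<circ> g) (f \<circ> h)"
      using h f unfolding pointed_homotopic_def pointed_map_def
      by (simp add: homotopic_with_compose_continuous_map_left)
    then show ?thesis
      using pointed_class_eq_iff[OF fg] by blast
  qed
  then have const: "?c h = ?c g" if "h \<in> pointed_class (nsphere n) sphere_point X x0 g" for h
    using that unfolding pointed_class_def by blast
  have "g \<in> pointed_class (nsphere n) sphere_point X x0 g"
    using g by (simp add: pointed_class_def pointed_homotopic_refl)
  then show ?thesis
    unfolding induced_map_def by (intro SUP_eq_const const) auto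
qed

end

theory Submission
  imports Defs
begin

text \<open>
  The evaluation map \<open>F\<close> may be taken to ignore the sphere altogether, \<open>F (b, x) = f x\<close>: it restricts
  to \<open>f\<close> on the fibre, and all the freedom is left to the section. Its composite with the graph
  \<open>b \<mapsto> (b, g b)\<close> of a pointed map \<open>g\<close> into \<open>X\<close> is \<open>f \<circ> g\<close>, so every class in the image of
  \<open>\<pi>\<^sub>n(f)\<close> is a relaxed evaluation class. Surjectivity then gives all of \<open>\<pi>\<^sub>n(Y)\<close>.
\<close>

lemma homotopy_section_graph:
  assumes g: "pointed_map B b0 X x0 g"
  shows "homotopy_section B b0 X x0 (\<lambda>b. (b, g b))"
proof -
  have "fst \<circ> (\<lambda>b. (b, g b)) = id"
    by auto
  moreover have "pointed_map B b0 B b0 id"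
    by (simp add: pointed_map_def)
  ultimately show ?thesis
    using g
    by (simp add: homotopy_section_def pointed_homotopic_refl pointed_map_def
        continuous_map_pairedI)
qed

text \<open>
  The graph of a representative \<open>g\<close> serves as the section, and \<open>f \<circ> snd\<close> as the evaluation map.
  The freedom in the section is essential: for the identity map of the 2-sphere and \<open>n = 2\<close>, the
  constant section \<open>b \<mapsto> (b, x0)\<close> alone would not yield the generator of the homotopy group,
  because its Whitehead square is non-zero.
\<close>
lemma induced_map_image_subset_relaxed_evaluation_subgroup:
  assumes f: "pointed_map X x0 Y y0 f"
  shows "induced_map n Y y0 f ` homotopy_group n X x0 \<subseteq> relaxed_evaluation_subgroup n Y y0 X x0 f"
proof (rule image_subsetI)
  fix a assume "a \<in> homotopy_group n X x0"
  then obtain g where g: "pointed_map (nsphere n) sphere_point X x0 g"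
    and a: "a = pointed_class (nsphere n) sphere_point X x0 g"
    by (auto simp: homotopy_group_def)
  let ?s = "\<lambda>b. (b, g b)" and ?F = "f \<circ> snd"
  have class_eq: "induced_map n Y y0 f a = pointed_class (nsphere n) sphere_point Y y0 (f \<circ> g)"
    unfolding a using f g by (rule induced_map_class)
  have "pointed_map (nsphere n) sphere_point Y y0 (f \<circ> g)"
    using f g by (auto simp: pointed_map_def intro: continuous_map_compose)
  then have "induced_map n Y y0 f a \<in> homotopy_group n Y y0"
    unfolding class_eq homotopy_group_def by blast
  moreover have "homotopy_section (nsphere n) sphere_point X x0 ?s"
    using g by (rule homotopy_section_graph)
  moreover have "pointed_map (prod_topology (nsphere n) X) (sphere_point, x0) Y y0 ?F"
    using f by (auto simp: pointed_map_def intro: continuous_map_compose continuous_map_snd)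
  moreover have "?F \<circ> ?s = f \<circ> g"
    by auto
  then have "pointed_class (nsphere n) sphere_point Y y0 (?F \<circ> ?s) = induced_map n Y y0 f a"
    by (simp only: class_eq)
  moreover have "?F \<circ> fibre_incl sphere_point = f"
    by (auto simp: fibre_incl_def)
  then have "pointed_homotopic X x0 Y y0 (?F \<circ> fibre_incl sphere_point) f"
    using f by (simp only: pointed_homotopic_refl)
  ultimately show "induced_map n Y y0 f a \<in> relaxed_evaluation_subgroup n Y y0 X x0 f"
    unfolding relaxed_evaluation_subgroup_def by blast
qed

theorem proposition1p5:
  fixes X :: "'a topology" and x0 :: 'a
    and Y :: "'b topology" and y0 :: 'b
    and f :: "'a \<Rightarrow> 'b" and n :: nat
  assumes "n \<ge> 1"
    and "CW_complex X" and "connected_space X" and "x0 \<in> topspace X"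
    and "CW_complex Y" and "connected_space Y" and "y0 \<in> topspace Y"
    and "pointed_map X x0 Y y0 f"
    and "induced_map n Y y0 f ` homotopy_group n X x0 = homotopy_group n Y y0"
  shows "relaxed_evaluation_subgroup n Y y0 X x0 f = homotopy_group n Y y0"
proof
  show "relaxed_evaluation_subgroup n Y y0 X x0 f \<subseteq> homotopy_group n Y y0"
    by (auto simp: relaxed_evaluation_subgroup_def)
  show "homotopy_group n Y y0 \<subseteq> relaxed_evaluation_subgroup n Y y0 X x0 f"
    using induced_map_image_subset_relaxed_evaluation_subgroup[OF assms(8)] assms(9) by metis
qed

end
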